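(* Let $P\in\mathcal{C}(G_n)$ and let $\mathrm{char}(P)=C$. Then \[\mathrm{char}(\mathrm{weave}_k^1(P))=\{T^k: T\in C\} \cup\{Q_{n+1}\}.\]
   Context: Let $Q_n=\{1,\dots,n\}$ be a set of $n$ yes/no questions; an outcome on $S\subseteq Q_n$ is an element of $\{0,1\}^{|S|}$, and $X_S$ is the set of outcomes on $S$. A preference matrix on $Q_n$ is a $2^n\times n$ 0-1 matrix whose rows are the $2^n$ outcomes, each exactly once, ordered from most to least preferred. For a nonempty proper $S\subset Q_n$ and outcome $x$ on $Q_n-S$, $P^{[Q_n-S,x]}$ is the submatrix formed by the columns in $S$ and rows with outcome $x$ on $Q_n-S$ (in order); $S$ is separable with respect to $P$ if $P^{[Q_n-S,x]}=P^{[Q_n-S,y]}$ for all $x,y\in X_{Q_n-S}$; $\emptyset$ and $Q_n$ are always separable. The character $\mathrm{char}(P)$ is the set of all subsets of $Q_n$ separable with respect to $P$. $\mathcal{C}(G_n)$ is the set of preference matrices generated by Hamiltonian paths in the $n$-dimensional hypercube graph $G_n$ with Gray code labeling, i.e. preference matrices in which consecutive rows differ in exactly one entry. For $A\in\mathcal{C}(G_n)$ and $k\in\{1,\dots,n+1\}$, $\mathrm{weave}_k^1(A)$ is the $2^{n+1}\times(n+1)$ matrix obtained by duplicating each row of $A$ (rows $2i-1$ and $2i$ both equal row $i$ of $A$) and inserting a new column in position $k$ (shifting later columns right) whose $i$-th entry is $1$ if $i\equiv 0,1 \pmod 4$ and $0$ if $i\equiv 2,3\pmod 4$. For $T\subseteq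 Q_n$, $T^k=\{q\in T : q<k\}\cup\{q+1 : q\in T \text{ and } q \geq k\}$. *)

theory Defs
  imports "Jordan_Normal_Form.DL_Submatrix" "HOL-Library.FuncSet"
begin

text \<open>
  Questions are numbered from 1, while the rows and columns of a matrix are indexed from 0:
  question \<open>q\<close> is stored in column \<open>q - 1\<close>, and the \<open>r\<close>-th row (counted from 1) has index \<open>r - 1\<close>.
\<close>

definition questions :: "nat \<Rightarrow> nat set" where
  "questions n = {1..n}"

definition outcomes :: "nat set \<Rightarrow> (nat \<Rightarrow> nat) set" where
  "outcomes S = S \<rightarrow>\<^sub>E {0, 1}"

definition outcome_at :: "nat mat \<Rightarrow> nat \<Rightarrow> nat set \<Rightarrow> nat \<Rightarrow> nat" where
  "outcome_at P i S = (\<lambda>q\<in>S. P $$ (i, q - 1))"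

definition preference_matrix :: "nat \<Rightarrow> nat mat \<Rightarrow> bool" where
  "preference_matrix n P \<longleftrightarrow>
     P \<in> carrier_mat (2 ^ n) n \<and>
     bij_betw (\<lambda>i. outcome_at P i (questions n)) {..<2 ^ n} (outcomes (questions n))"

definition conditional_submatrix :: "nat mat \<Rightarrow> nat set \<Rightarrow> (nat \<Rightarrow> nat) \<Rightarrow> nat mat" where
  "conditional_submatrix P S x =
     submatrix P
       {i. i < dim_row P \<and> outcome_at P i (questions (dim_col P) - S) = x}
       {j. Suc j \<in> S}"

definition separable :: "nat mat \<Rightarrow> nat set \<Rightarrow> bool" where
  "separable P S \<longleftrightarrow>
     S = {} \<or> S = questions (dim_col P) \<or>
     (\<forall>x \<in> outcomes (questions (dim_col P) - S). \<forall>y \<in> outcomes (questions (dim_col P) - S).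
        conditional_submatrix P S x = conditional_submatrix P S y)"

definition character :: "nat mat \<Rightarrow> nat set set" where
  "character P = {S. S \<subseteq> questions (dim_col P) \<and> separable P S}"

text \<open>
  The vertices of the \<open>n\<close>-dimensional hypercube are the outcomes on all \<open>n\<close> questions.  As the rows
  of a preference matrix list every vertex exactly once, they form a Hamiltonian path precisely
  when consecutive rows are adjacent.
\<close>

definition hypercube_adj :: "nat \<Rightarrow> (nat \<Rightarrow> nat) \<Rightarrow> (nat \<Rightarrow> nat) \<Rightarrow> bool" where
  "hypercube_adj n x y \<longleftrightarrow>
     x \<in> outcomes (questions n) \<and> y \<in> outcomes (questions n) \<and>
     card {q \<in> questions n. x q \<noteq> y q} = 1"

definition hypercube_path_matrices :: "nat \<Rightarrow> nat mat set" where
  "hypercube_path_matrices n =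
     {P. preference_matrix n P \<and>
         (\<forall>i. Suc i < 2 ^ n \<longrightarrow>
            hypercube_adj n (outcome_at P i (questions n)) (outcome_at P (Suc i) (questions n)))}"

text \<open>In the case distinction, \<open>Suc i\<close> and \<open>Suc j\<close> are the row and column numbers counted from 1.\<close>

definition weave1 :: "nat \<Rightarrow> nat mat \<Rightarrow> nat mat" where
  "weave1 k A = mat (2 * dim_row A) (Suc (dim_col A))
     (\<lambda>(i, j). if Suc j < k then A $$ (i div 2, j)
               else if Suc j = k then (if Suc i mod 4 \<in> {0, 1} then 1 else 0)
               else A $$ (i div 2, j - 1))"

definition shift_questions :: "nat \<Rightarrow> nat set \<Rightarrow> nat set" where
  "shift_questions k T = {q \<in> T. q < k} \<union> {q + 1 |q. q \<in> T \<and> q \<ge> k}"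

end

theory Submission
  imports Defs
begin

text \<open>Row \<open>r\<close> of \<open>P\<close> becomes rows \<open>2 * r\<close> and
  \<open>2 * r + 1\<close> of the weave. The two copies answer the new question \<open>k\<close>
  differently, and the first copy answers 1 exactly when \<open>r\<close> is even. For a set
  avoiding \<open>k\<close>, an outcome on the complement prescribes the answer to \<open>k\<close>,
  so exactly one copy of each compatible row of \<open>P\<close> survives. The conditional
  submatrices are therefore those of \<open>P\<close> (\<open>conditional_submatrix_weave1\<close>),
  and separability transfers in both directions (\<open>separable_weave1_shift_questions\<close>).
  The sets avoiding \<open>k\<close> are the shifted ones. For a proper subset containing
  \<open>k\<close>, the new column betrays the parity of the row index in \<open>P\<close>. The
  hypercube is bipartite, so a Hamiltonian path alternates between its parity classes
  (\<open>even_sum_outcome_at_path\<close>). Separability would produce adjacent vertices at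
  positions of equal parity (\<open>not_separable_weave1\<close>). Hence the full set is the only
  separable set containing \<open>k\<close>.\<close>

section \<open>Reindexing submatrices\<close>

text \<open>An element is picked according to how many members of the set lie below it, and a
  strictly increasing map preserves that number.\<close>

lemma pick_image_strict_mono:
  assumes "strict_mono g" and "n < card I \<or> infinite I"
  shows "pick (g ` I) n = g (pick I n)"
proof -
  let ?i = "pick I n"
  have "{b \<in> g ` I. b < g ?i} = g ` {a \<in> I. a < ?i}"
    using assms(1) by (auto simp: strict_mono_less)
  then have "card {b \<in> g ` I. b < g ?i} = n"
    using card_pick[OF assms(2)] card_image[OF inj_on_subset[OF strict_mono_imp_inj_on[OF assms(1)]]]
    by (metis subset_UNIV)
  then show ?thesis
    using pick_card_in_set[of "g ?i" "g ` I"] pick_in_set[OF assms(2)] by auto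
qed

lemma submatrix_image_strict_mono:
  assumes "strict_mono g" and "strict_mono h"
    and I: "I \<subseteq> {..<dim_row A}" "g ` I \<subseteq> {..<dim_row B}"
    and J: "J \<subseteq> {..<dim_col A}" "h ` J \<subseteq> {..<dim_col B}"
    and entries: "\<And>i j. i \<in> I \<Longrightarrow> j \<in> J \<Longrightarrow> B $$ (g i, h j) = A $$ (i, j)"
  shows "submatrix B (g ` I) (h ` J) = submatrix A I J"
proof -
  have "{i. i < dim_row A \<and> i \<in> I} = I" "{i. i < dim_row B \<and> i \<in> g ` I} = g ` I"
    "{j. j < dim_col A \<and> j \<in> J} = J" "{j. j < dim_col B \<and> j \<in> h ` J} = h ` J"
    using I J by auto
  moreover have "card (g ` I) = card I" "card (h ` J) = card J"
    using assms(1,2) strict_mono_imp_inj_on inj_on_subset by (blast intro: card_image)+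
  ultimately show ?thesis
    unfolding submatrix_def
    by (auto intro!: cong_mat simp: pick_image_strict_mono assms(1,2) entries pick_in_set)
qed

lemma outcomes_iff:
  "x \<in> outcomes S \<longleftrightarrow> x \<in> extensional S \<and> (\<forall>q\<in>S. x q = 0 \<or> x q = 1)"
  by (auto simp: outcomes_def PiE_def)

lemma outcome_at_eq_iff:
  assumes "x \<in> extensional S"
  shows "outcome_at P i S = x \<longleftrightarrow> (\<forall>q\<in>S. P $$ (i, q - 1) = x q)"
  using assms by (auto simp: outcome_at_def fun_eq_iff extensional_def)

section \<open>Shifted questions and the entries of the weave\<close>

text \<open>Pointwise form of the shift, which makes \<open>shift_questions\<close> an image under
  an injection whose range misses \<open>k\<close>.\<close>

definition shift_question :: "nat \<Rightarrow> nat \<Rightarrow> nat" where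
  "shift_question k q = (if q < k then q else Suc q)"

lemma shift_questions_eq_image: "shift_questions k T = shift_question k ` T"
  by (auto simp: shift_questions_def shift_question_def)

lemma shift_question_inject [simp]: "shift_question k p = shift_question k q \<longleftrightarrow> p = q"
  by (auto simp: shift_question_def)

lemma shift_question_neq [simp]: "shift_question k q \<noteq> k" "k \<noteq> shift_question k q"
  by (auto simp: shift_question_def)

lemma questions_Suc_eq:
  assumes "k \<in> {1..Suc n}"
  shows "questions (Suc n) = insert k (shift_question k ` questions n)"
proof
  show "questions (Suc n) \<subseteq> insert k (shift_question k ` questions n)"
  proof
    fix q assume q: "q \<in> questions (Suc n)"
    consider "q < k" | "q = k" | "q > k" by linarith
    then show "q \<in> insert k (shift_question k ` questions n)"
    proof cases
      case 1
      then have "q = shift_question k q" "q \<in> questions n"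
        using q assms by (auto simp: shift_question_def questions_def)
      then show ?thesis by blast
    next
      case 3
      then have "q = shift_question k (q - 1)" "q - 1 \<in> questions n"
        using q assms by (auto simp: shift_question_def questions_def)
      then show ?thesis by blast
    qed simp
  qed
qed (use assms in \<open>auto simp: questions_def shift_question_def\<close>)

lemma dim_weave1 [simp]:
  "dim_row (weave1 k P) = 2 * dim_row P" "dim_col (weave1 k P) = Suc (dim_col P)"
  by (simp_all add: weave1_def)

lemma weave1_shift_question:
  assumes "i < 2 * dim_row P" and "q \<in> questions (dim_col P)"
  shows "weave1 k P $$ (i, shift_question k q - 1) = P $$ (i div 2, q - 1)"
  using assms by (auto simp: weave1_def shift_question_def questions_def)

text \<open>With rows counted from 0 the column repeats 1, 0, 0, 1. The parity form separates the
  choice of copy (\<open>even i\<close>) from the parity of the original row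
  (\<open>even (i div 2)\<close>).\<close>

lemma weave1_new_question:
  assumes "i < 2 * dim_row P" and "k \<in> {1..Suc (dim_col P)}"
  shows "weave1 k P $$ (i, k - 1) = of_bool (even i \<longleftrightarrow> even (i div 2))"
proof -
  have "Suc i mod 4 \<in> {0, 1} \<longleftrightarrow> (even i \<longleftrightarrow> even (i div 2))"
    unfolding insert_iff empty_iff by presburger
  then show ?thesis using assms by (auto simp: weave1_def)
qed

section \<open>Sets avoiding the new question\<close>

lemma outcome_at_weave1_eq_iff:
  assumes "k \<in> {1..Suc (dim_col P)}" and "i < 2 * dim_row P" and "D \<subseteq> questions (dim_col P)"
    and "x \<in> outcomes (insert k (shift_question k ` D))"
  shows "outcome_at (weave1 k P) i (insert k (shift_question k ` D)) = x \<longleftrightarrow>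
    outcome_at P (i div 2) D = restrict (x \<circ> shift_question k) D \<and>
    x k = of_bool (even i \<longleftrightarrow> even (i div 2))"
proof -
  have shifted: "weave1 k P $$ (i, shift_question k q - 1) = P $$ (i div 2, q - 1)" if "q \<in> D" for q
    using weave1_shift_question assms(2,3) that by blast
  have "x \<in> extensional (insert k (shift_question k ` D))"
    using assms(4) by (simp add: outcomes_iff)
  then show ?thesis
    by (simp add: outcome_at_eq_iff shifted[simplified]
        weave1_new_question[OF assms(2,1), simplified] conj_commute eq_commute[of "x k"])
qed

text \<open>Of the two copies of a compatible row exactly one has the answer \<open>x k\<close>.
  Choosing it is strictly increasing in the row, so order is kept and the submatrix is only
  reindexed.\<close>

lemma conditional_submatrix_weave1:
  assumes k: "k \<in> {1..Suc (dim_col P)}" and T: "T \<subseteq> questions (dim_col P)"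
    and x: "x \<in> outcomes (questions (Suc (dim_col P)) - shift_question k ` T)"
  shows "conditional_submatrix (weave1 k P) (shift_question k ` T) x =
    conditional_submatrix P T (restrict (x \<circ> shift_question k) (questions (dim_col P) - T))"
proof -
  define D where "D = questions (dim_col P) - T"
  define I where "I = {r. r < dim_row P \<and> outcome_at P r D = restrict (x \<circ> shift_question k) D}"
  define J where "J = {j. Suc j \<in> T}"
  \<comment> \<open>The copy of row \<open>r\<close> that answers \<open>x k\<close>: the second
    copy answers 1 for odd \<open>r\<close> and 0 for even \<open>r\<close>.\<close>
  define g where "g r = 2 * r + of_bool (x k = 1 \<longleftrightarrow> odd r)" for r :: nat
  \<comment> \<open>\<open>shift_question k\<close> in terms of column indices, which start at
    0.\<close>
  define h where "h j = (if Suc j < k then j else Suc j)" for j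
  have D': "questions (Suc (dim_col P)) - shift_question k ` T = insert k (shift_question k ` D)"
    unfolding questions_Suc_eq[OF k] D_def by auto
  have xk: "x k = 0 \<or> x k = 1"
    using x unfolding D' by (auto simp: outcomes_def)
  have DQ: "D \<subseteq> questions (dim_col P)" by (auto simp: D_def)
  have g_div: "g r div 2 = r" for r by (simp add: g_def)
  have g_iff: "i = g (i div 2) \<longleftrightarrow> x k = of_bool (even i \<longleftrightarrow> even (i div 2))" for i
    using xk by (cases "even i") (auto simp: g_def elim!: evenE oddE)
  have row_iff: "outcome_at (weave1 k P) i (insert k (shift_question k ` D)) = x \<longleftrightarrow>
      i div 2 \<in> I \<and> i = g (i div 2)" if "i < 2 * dim_row P" for i
    unfolding outcome_at_weave1_eq_iff[OF k that DQ x[unfolded D']] g_iff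
    using that by (auto simp: I_def)
  have g_less: "g r < 2 * dim_row P" if "r \<in> I" for r
    using that by (auto simp: I_def g_def)
  have rows: "{i. i < 2 * dim_row P \<and>
      outcome_at (weave1 k P) i (insert k (shift_question k ` D)) = x} = g ` I"
  proof (intro Set.set_eqI iffI)
    fix i assume "i \<in> g ` I"
    then show "i \<in> {i. i < 2 * dim_row P \<and>
        outcome_at (weave1 k P) i (insert k (shift_question k ` D)) = x}"
      using row_iff g_less g_div by auto
  qed (use row_iff in blast)
  have Suc_h: "Suc (h j) = shift_question k (Suc j)" for j
    by (simp add: h_def shift_question_def)
  have cols: "{j. Suc j \<in> shift_question k ` T} = h ` J"
  proof (intro Set.set_eqI iffI)
    fix j assume "j \<in> {j. Suc j \<in> shift_question k ` T}"
    then obtain q where q: "q \<in> T" "Suc j = shift_question k q" by blast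
    \<comment> \<open>Questions start at 1, so the truncated subtraction is harmless.\<close>
    then have "Suc (q - 1) = q" using T by (auto simp: questions_def)
    then have "j = h (q - 1)" "q - 1 \<in> J"
      using q Suc_h[of "q - 1"] by (simp_all add: J_def)
    then show "j \<in> h ` J" by blast
  qed (auto simp: J_def Suc_h)
  have "submatrix (weave1 k P) (g ` I) (h ` J) = submatrix P I J"
  proof (rule submatrix_image_strict_mono)
    show "strict_mono g" by (rule strict_monoI) (auto simp: g_def)
    show "strict_mono h" by (rule strict_monoI) (auto simp: h_def)
    show "I \<subseteq> {..<dim_row P}" "g ` I \<subseteq> {..<dim_row (weave1 k P)}"
      by (auto simp: I_def g_def)
    show "J \<subseteq> {..<dim_col P}" "h ` J \<subseteq> {..<dim_col (weave1 k P)}"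
      using T by (auto simp: J_def h_def questions_def)
    show "weave1 k P $$ (g r, h j) = P $$ (r, j)" if "r \<in> I" "j \<in> J" for r j
      using weave1_shift_question[of "g r" P "Suc j" k] that T g_div[of r]
      by (auto simp: I_def J_def Suc_h[symmetric] g_def)
  qed
  then show ?thesis
    by (simp add: conditional_submatrix_def D' rows cols I_def[symmetric] J_def[symmetric]
        D_def[symmetric])
qed

text \<open>The submatrices of the weave depend on \<open>x\<close> only through its pullback
  \<open>u x\<close> to the old questions, and these pullbacks exhaust the outcomes on the
  complement of \<open>T\<close>.\<close>

lemma separable_weave1_shift_questions:
  assumes k: "k \<in> {1..Suc (dim_col P)}" and T: "T \<subseteq> questions (dim_col P)"
  shows "separable (weave1 k P) (shift_questions k T) \<longleftrightarrow> separable P T"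
proof (cases "T = {}")
  case False
  define D where "D = questions (dim_col P) - T"
  define D' where "D' = questions (Suc (dim_col P)) - shift_question k ` T"
  define u where "u x = restrict (x \<circ> shift_question k) D" for x :: "nat \<Rightarrow> nat"
  have D'_eq: "D' = insert k (shift_question k ` D)"
    unfolding questions_Suc_eq[OF k] D_def D'_def by auto
  have u: "u ` outcomes D' = outcomes D"
  proof
    show "u ` outcomes D' \<subseteq> outcomes D"
      by (auto simp: u_def outcomes_iff D'_eq)
    show "outcomes D \<subseteq> u ` outcomes D'"
    proof
      fix y assume y: "y \<in> outcomes D"
      define v where "v q = (if q < k then q else q - 1)" for q
      have v: "v (shift_question k q) = q" for q
        by (simp add: v_def shift_question_def)
      \<comment> \<open>An extension of \<open>y\<close>; the answer 0 to \<open>k\<close> is an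
        arbitrary choice.\<close>
      let ?x = "\<lambda>q\<in>D'. if q = k then 0 else y (v q)"
      have "y = u ?x"
      proof
        fix q show "y q = u ?x q"
          using y by (cases "q \<in> D") (auto simp: u_def D'_eq v outcomes_iff extensional_def)
      qed
      moreover have "?x \<in> outcomes D'"
        using y by (auto simp: outcomes_iff D'_eq v)
      ultimately show "y \<in> u ` outcomes D'" by blast
    qed
  qed
  have "k \<in> questions (Suc (dim_col P))" using k by (auto simp: questions_def)
  then have "shift_question k ` T \<noteq> questions (Suc (dim_col P))"
    by (metis imageE shift_question_neq(2))
  then have "separable (weave1 k P) (shift_questions k T) \<longleftrightarrow>
      (\<forall>x\<in>outcomes D'. \<forall>y\<in>outcomes D'.
         conditional_submatrix P T (u x) = conditional_submatrix P T (u y))"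
    using False conditional_submatrix_weave1[OF k T]
    by (simp add: separable_def shift_questions_eq_image u_def D_def D'_def)
  also have "\<dots> \<longleftrightarrow> (\<forall>x\<in>outcomes D. \<forall>y\<in>outcomes D.
         conditional_submatrix P T x = conditional_submatrix P T y)"
    unfolding u[symmetric] by blast
  also have "\<dots> \<longleftrightarrow> separable P T"
  proof (cases "T = questions (dim_col P)")
    case True
    \<comment> \<open>Here \<open>P\<close> has separability by convention, while the weave is
      tested through submatrices. The test is trivial, as the empty complement has only one
      outcome.\<close>
    then have "outcomes D = {\<lambda>_. undefined}" by (simp add: D_def outcomes_def)
    then show ?thesis using True by (simp add: separable_def)
  qed (use False in \<open>simp add: separable_def D_def\<close>)
  finally show ?thesis .
qed (simp add: separable_def shift_questions_eq_image)

section \<open>Parity along Hamiltonian paths\<close>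

text \<open>Modulo 2, the combined sum counts the coordinates where the vertices differ, and there
  is exactly one.\<close>

lemma odd_sum_hypercube_adj:
  assumes "hypercube_adj n x y"
  shows "odd (sum x (questions n) + sum y (questions n))"
proof -
  have "odd (x q + y q) \<longleftrightarrow> x q \<noteq> y q" if "q \<in> questions n" for q
  proof -
    have "x q = 0 \<or> x q = 1" "y q = 0 \<or> y q = 1"
      using assms that by (auto simp: hypercube_adj_def outcomes_iff)
    then show ?thesis by auto
  qed
  then have "{q \<in> questions n. odd (x q + y q)} = {q \<in> questions n. x q \<noteq> y q}"
    by blast
  then show ?thesis
    using assms by (simp add: sum.distrib[symmetric] even_sum_iff hypercube_adj_def questions_def
        del: even_add)
qed

text \<open>Each step flips the parity of both the coordinate sum and the row index, so the parity
  of their total is invariant.\<close>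

lemma even_sum_outcome_at_path:
  assumes "P \<in> hypercube_path_matrices n" and "r < 2 ^ n"
  shows "even (sum (outcome_at P r (questions n)) (questions n) + r) \<longleftrightarrow>
    even (sum (outcome_at P 0 (questions n)) (questions n))"
  using assms(2)
proof (induction r)
  case (Suc r)
  then have "hypercube_adj n (outcome_at P r (questions n)) (outcome_at P (Suc r) (questions n))"
    using assms(1) by (simp add: hypercube_path_matrices_def)
  from odd_sum_hypercube_adj[OF this] show ?case using Suc by auto
qed simp

text \<open>A path in the (bipartite) hypercube alternates between the two parity classes.\<close>

lemma parity_adjacent_rows:
  assumes "P \<in> hypercube_path_matrices n" and "r < 2 ^ n" and "s < 2 ^ n"
    and "hypercube_adj n (outcome_at P r (questions n)) (outcome_at P s (questions n))"
  shows "even r \<noteq> even s"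
  using even_sum_outcome_at_path[OF assms(1,2)] even_sum_outcome_at_path[OF assms(1,3)]
    odd_sum_hypercube_adj[OF assms(4)] by auto

section \<open>Proper subsets containing the new question\<close>

lemma outcome_at_surj:
  assumes "preference_matrix n P" and "x \<in> outcomes (questions n)"
  obtains r where "r < 2 ^ n" and "outcome_at P r (questions n) = x"
proof -
  have "x \<in> (\<lambda>i. outcome_at P i (questions n)) ` {..<2 ^ n}"
    using assms by (auto simp: preference_matrix_def bij_betw_def)
  then show ?thesis using that by blast
qed

lemma outcome_at_in_outcomes:
  assumes "preference_matrix n P" and "r < 2 ^ n"
  shows "outcome_at P r (questions n) \<in> outcomes (questions n)"
  using assms by (auto simp: preference_matrix_def bij_betw_def)

text \<open>
  Let \<open>k \<in> S\<close> and \<open>q0 \<notin> S\<close>.  The rows of the weave compatible with an outcome on the complement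
  of \<open>S\<close> come in pairs, so the first such row has an even index \<open>2 * r\<close>, and its answer to
  question \<open>k\<close> records the parity of \<open>r\<close>.  If \<open>S\<close> were separable, two outcomes differing only at
  \<open>q0\<close> would yield first rows that agree on \<open>S\<close>, that is, rows of \<open>P\<close> which are adjacent in the
  hypercube but have indices of the same parity.
\<close>

lemma not_separable_weave1:
  assumes P: "P \<in> hypercube_path_matrices n" and k: "k \<in> {1..Suc n}"
    and S: "S \<subseteq> questions (Suc n)" "k \<in> S" "S \<noteq> questions (Suc n)"
  shows "\<not> separable (weave1 k P) S"
proof
  let ?s = "shift_question k"
  let ?W = "weave1 k P"
  assume sep: "separable ?W S"
  have pm: "preference_matrix n P" using P by (simp add: hypercube_path_matrices_def)
  then have dims: "dim_row P = 2 ^ n" "dim_col P = n"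
    by (auto simp: preference_matrix_def)
  define D where "D = questions (Suc n) - S"
  obtain q0 where q0: "q0 \<in> questions n" "?s q0 \<in> D"
    using S questions_Suc_eq[OF k] by (auto simp: D_def)
  define I where "I x = {i. i < dim_row ?W \<and> outcome_at ?W i D = x}" for x
  define J where "J = {j. Suc j \<in> S}"
  \<comment> \<open>\<open>z 0\<close> and \<open>z 1\<close> are the two outcomes on the complement
    that differ only at the shifted \<open>q0\<close>; \<open>f c\<close> is the index of the first
    row compatible with \<open>z c\<close>.\<close>
  define z where "z c = (\<lambda>q\<in>D. if q = ?s q0 then c else 0)" for c :: nat
  define f where "f c = pick (I (z c)) 0" for c
  have D_s: "q \<in> ?s ` questions n" if "q \<in> D" for q
    using that S questions_Suc_eq[OF k] by (auto simp: D_def)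
  have z_out: "z c \<in> outcomes D" if "c \<in> {0, 1}" for c
    using that by (auto simp: z_def outcomes_def)
  have z_ext: "z c \<in> extensional D" for c by (simp add: z_def)
  \<comment> \<open>Since \<open>k\<close> is not in \<open>D\<close>, the new column imposes no
    condition, and compatibility depends on \<open>i div 2\<close> alone.\<close>
  have mem_I: "i \<in> I (z c) \<longleftrightarrow> i < 2 * 2 ^ n \<and>
      (\<forall>q\<in>questions n. ?s q \<in> D \<longrightarrow> P $$ (i div 2, q - 1) = (if q = q0 then c else 0))" for i c
  proof (cases "i < 2 * 2 ^ n")
    case True
    have "outcome_at ?W i D = z c \<longleftrightarrow> (\<forall>q\<in>questions n. ?s q \<in> D \<longrightarrow> ?W $$ (i, ?s q - 1) = z c (?s q))"
      unfolding outcome_at_eq_iff[OF z_ext] using D_s by blast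
    also have "\<dots> \<longleftrightarrow>
        (\<forall>q\<in>questions n. ?s q \<in> D \<longrightarrow> P $$ (i div 2, q - 1) = (if q = q0 then c else 0))"
      by (intro ball_cong refl imp_cong)
        (use True in \<open>simp add: dims weave1_shift_question z_def del: One_nat_def\<close>)
    finally show ?thesis using True by (simp add: I_def dims)
  qed (simp add: I_def dims)
  have fin: "finite (I x)" for x by (simp add: I_def)
  have f_mem: "f c \<in> I (z c)" if c: "c \<in> {0, 1}" for c
  proof -
    have "(\<lambda>q\<in>questions n. if q = q0 then c else 0) \<in> outcomes (questions n)"
      using c by (auto simp: outcomes_def)
    then obtain r where r: "r < 2 ^ n"
      "outcome_at P r (questions n) = (\<lambda>q\<in>questions n. if q = q0 then c else 0)"
      using outcome_at_surj[OF pm] by blast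
    have "P $$ (r, q - 1) = (if q = q0 then c else 0)" if "q \<in> questions n" for q
      using fun_cong[OF r(2), of q] that by (simp add: outcome_at_def)
    then have "2 * r \<in> I (z c)" using r(1) by (auto simp: mem_I)
    then have "card (I (z c)) > 0" using fin card_gt_0_iff by blast
    then show ?thesis unfolding f_def by (intro pick_in_set) simp
  qed
  have f_even: "even (f c)" if c: "c \<in> {0, 1}" for c
  proof (rule ccontr)
    \<comment> \<open>An odd first row would be preceded by its twin, which is equally
      compatible.\<close>
    assume odd: "odd (f c)"
    then have "(f c - 1) div 2 = f c div 2" by (auto elim: oddE)
    then have "f c - 1 \<in> I (z c)" using f_mem[OF c] by (auto simp: mem_I)
    then have "f c \<le> f c - 1" unfolding f_def pick.simps by (intro Least_le)
    then show False using odd by (cases "f c") auto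
  qed
  have f_less: "f c < 2 * 2 ^ n" if "c \<in> {0, 1}" for c
    using f_mem[OF that] by (simp add: mem_I)
  have agree: "?W $$ (f 0, q - 1) = ?W $$ (f 1, q - 1)" if q: "q \<in> S" for q
  proof -
    have Sq: "Suc (q - 1) = q" "q \<le> Suc n" using q S by (auto simp: questions_def)
    \<comment> \<open>The position of question \<open>q\<close> among the columns of
      \<open>S\<close>; row 0 of the conditional submatrix is row \<open>f c\<close> of the
      weave.\<close>
    let ?j = "card {a \<in> J. a < q - 1}"
    have qJ: "q - 1 \<in> J" using q Sq by (simp add: J_def)
    have j: "pick J ?j = q - 1" by (rule pick_card_in_set[OF qJ])
    have "q - 1 < dim_col ?W" using Sq dims by simp
    then have "{a \<in> J. a < q - 1} \<subseteq> {j. j < dim_col ?W \<and> j \<in> J}"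
      and "q - 1 \<in> {j. j < dim_col ?W \<and> j \<in> J}" and "q - 1 \<notin> {a \<in> J. a < q - 1}"
      using qJ by auto
    then have "{a \<in> J. a < q - 1} \<subset> {j. j < dim_col ?W \<and> j \<in> J}" by blast
    then have less: "?j < card {j. j < dim_col ?W \<and> j \<in> J}"
      by (rule psubset_card_mono[rotated]) simp
    have entry: "conditional_submatrix ?W S (z c) $$ (0, ?j) = ?W $$ (f c, q - 1)"
      if c: "c \<in> {0, 1}" for c
    proof -
      have cs: "conditional_submatrix ?W S (z c) = submatrix ?W (I (z c)) J"
        by (simp add: conditional_submatrix_def I_def J_def D_def dims)
      have "{i. i < dim_row ?W \<and> i \<in> I (z c)} = I (z c)" by (auto simp: I_def)
      then have "0 < card {i. i < dim_row ?W \<and> i \<in> I (z c)}"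
        using f_mem[OF c] fin card_gt_0_iff by (metis empty_iff)
      from submatrix_index[OF this less] show ?thesis by (simp only: cs j f_def)
    qed
    have "conditional_submatrix ?W S (z 0) = conditional_submatrix ?W S (z 1)"
      using sep S z_out[of 0] z_out[of 1] by (auto simp: separable_def D_def dims)
    then show ?thesis using entry[of 0] entry[of 1] by simp
  qed
  define r where "r c = f c div 2" for c
  have r_less: "r c < 2 ^ n" if "c \<in> {0, 1}" for c
    using f_less[OF that] by (simp add: r_def)
  \<comment> \<open>As \<open>f c\<close> is even, its answer to \<open>k\<close> is the parity of
    \<open>r c\<close>; agreement at \<open>k\<close> thus forces equal parities.\<close>
  have "?W $$ (f c, k - 1) = of_bool (even (r c))" if "c \<in> {0, 1}" for c
    using weave1_new_question[of "f c" P k] f_less[OF that] f_even[OF that] k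
    by (simp add: dims r_def)
  from this[of 0] this[of 1] have "of_bool (even (r 0)) = (of_bool (even (r 1)) :: nat)"
    using agree[OF S(2)] by simp
  then have "even (r 0) \<longleftrightarrow> even (r 1)" by (simp only: of_bool_eq_iff)
  moreover have "hypercube_adj n (outcome_at P (r 0) (questions n)) (outcome_at P (r 1) (questions n))"
  proof -
    \<comment> \<open>On \<open>D\<close> the two rows show \<open>z 0\<close> and
      \<open>z 1\<close>, which differ only at \<open>q0\<close>; on \<open>S\<close> they coincide
      by \<open>agree\<close>.\<close>
    have eq: "P $$ (r 0, q - 1) \<noteq> P $$ (r 1, q - 1) \<longleftrightarrow> q = q0" if q: "q \<in> questions n" for q
    proof (cases "?s q \<in> D")
      case True
      then show ?thesis using f_mem[of 0] f_mem[of 1] q by (auto simp: mem_I r_def)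
    next
      case False
      then have "?s q \<in> S" using q questions_Suc_eq[OF k] by (auto simp: D_def)
      then have "P $$ (r 0, q - 1) = P $$ (r 1, q - 1)"
        using agree[of "?s q"] f_less[of 0] f_less[of 1] q
        by (simp add: weave1_shift_question dims r_def del: One_nat_def)
      then show ?thesis using False q0 by auto
    qed
    have "{q \<in> questions n. outcome_at P (r 0) (questions n) q \<noteq>
        outcome_at P (r 1) (questions n) q} = {q0}"
      using eq q0 by (auto simp: outcome_at_def)
    then show ?thesis
      using outcome_at_in_outcomes[OF pm] r_less by (simp add: hypercube_adj_def)
  qed
  ultimately show False using parity_adjacent_rows[OF P] r_less by auto
qed

theorem theorem6:
  fixes n k :: nat and P :: "nat mat" and C :: "nat set set"
  assumes "P \<in> hypercube_path_matrices n"
    and "k \<in> {1..n + 1}"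
    and "character P = C"
  shows "character (weave1 k P) = {shift_questions k T |T. T \<in> C} \<union> {questions (n + 1)}"
proof -
  have dim: "dim_col P = n"
    using assms(1) by (auto simp: hypercube_path_matrices_def preference_matrix_def)
  have k: "k \<in> {1..Suc n}" using assms(2) by simp
  note Q = questions_Suc_eq[OF k]
  have sep_iff: "separable (weave1 k P) (shift_questions k T) \<longleftrightarrow> separable P T"
    if "T \<subseteq> questions n" for T
    using separable_weave1_shift_questions[of k P T] k that by (simp add: dim)
  show ?thesis
  proof (intro equalityI subsetI)
    fix S assume "S \<in> character (weave1 k P)"
    then have S: "S \<subseteq> questions (Suc n)" "separable (weave1 k P) S"
      by (auto simp: character_def dim)
    show "S \<in> {shift_questions k T |T. T \<in> C} \<union> {questions (n + 1)}"
    proof (cases "k \<in> S")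
      case True
      then show ?thesis using not_separable_weave1[OF assms(1) k S(1)] S(2) by auto
    next
      case False
      then have "S \<subseteq> shift_question k ` questions n" using S(1) Q by auto
      then obtain T where T: "T \<subseteq> questions n" "S = shift_questions k T"
        by (auto simp: subset_image_iff shift_questions_eq_image)
      then have "T \<in> C" using S(2) sep_iff assms(3) by (auto simp: character_def dim)
      then show ?thesis using T(2) by blast
    qed
  next
    fix S assume "S \<in> {shift_questions k T |T. T \<in> C} \<union> {questions (n + 1)}"
    then consider T where "T \<in> C" "S = shift_questions k T" | "S = questions (Suc n)" by auto
    then show "S \<in> character (weave1 k P)"
    proof cases
      case 1
      then have "T \<subseteq> questions n" "separable P T"
        using assms(3) by (auto simp: character_def dim)
      then show ?thesis
        using 1 sep_iff Q by (auto simp: character_def dim shift_questions_eq_image)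
    next
      case 2
      then show ?thesis by (simp add: character_def separable_def dim)
    qed
  qed
qed

end
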